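(* Let $\alpha\in(0,1)$ and fix $\epsilon>0$ such that $\alpha-\epsilon>0$. Let $(X_1,Y_1),\dots,(X_n,Y_n),(X,Y)$ be i.i.d. random variables with values in $\mathbb{R}^d\times\mathbb{R}$ (with arbitrary common distribution), let $D=(X_i,Y_i)_{1\le i\le n}$, and let $D_1,D_2$ be a partition of $D$ into two disjoint subsamples, with $n_2=|D_2|$. Let $G_K=\{\tau_{(1)},\dots,\tau_{(K)}\}$ with $1>\tau_{(1)}>\dots>\tau_{(K)}>0$, and for each $\tau\in G_K$ let $N_\tau=N_{D_1,\tau}=(l_\tau,m_\tau,u_\tau)$ be a network fit on $D_1$ by minimizing the level-$\tau$ empirical risk on $D_1$. Let $$\hat p(N_\tau,D_2)=\frac{1}{n_2}\sum_{(X_i,Y_i)\in D_2}\mathbf{1}_{\{Y_i\in[l_\tau(X_i),u_\tau(X_i)]\}},$$ and let $\hat\tau=\tau_{(i)}$ for the smallest index $i\in\{1,\dots,K\}$ such that $\hat p(N_{\tau_{(i)}},D_2)\ge 1-(\alpha-\epsilon)$, and $\hat\tau=0$ if there is no such $i$. Set $\Gamma_{\alpha-\epsilon}^{\hat\tau}(x)=[l_{\hat\tau}(x),u_{\hat\tau}(x)]$, where $l_0\equiv-\infty$ and $u_0\equiv\infty$. Then for all $$n_2\ge\frac{-2\log\left(\epsilon/(2K(1-\alpha+\epsilon/2))\right)}{\epsilon^2}$$ we have $$\mathbb{P}\left(Y\in\Gamma_{\alpha-\epsilon}^{\hat\tau}(X)\right)\ge 1-\alpha,$$ where the probability is over both $D$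 and the new observation $(X,Y)$.
   Context: Data splitting: $D_1$ and $D_2$ correspond to a fixed (not data-dependent) partition of the index set $\{1,\dots,n\}$, with $D_2$ nonempty. The new observation $(X,Y)$ is independent of $D$ and has the same distribution as each $(X_i,Y_i)$. Networks: a network is a function $N=(l,m,u):\mathbb{R}^d\to\mathbb{R}^3$ with $l(x)\le m(x)\le u(x)$ for all $x\in\mathbb{R}^d$. The architecture (the class of networks considered) is arbitrary and may depend on the data only through $D_1$. Loss: for $\tau\in[0,1]$ and $u\in\mathbb{R}$ let $h_\tau(u)=(\tau-\mathbf{1}_{\{u\le 0\}})u$. The level-$\tau$ loss is $$\mathcal{L}_\tau(N(x),y)=h_{\tau/2}(y-l(x))+h_{1/2}(y-m(x))+h_{1-\tau/2}(y-u(x)),$$ and the empirical risk of $N$ on $D'\subseteq D$ is $$\mathcal{R}_{D',\tau}(N)=\frac{1}{|D'|}\sum_{(X_i,Y_i)\in D'}\mathcal{L}_\tau(N(X_i),Y_i).$$ The network $N_{D_1,\tau}$ is one fit on $D_1$ by minimizing $\mathcal{R}_{D_1,\tau}$; it depends on the data only through $D_1$, and $(D_1,x)\mapsto N_{D_1,\tau}(x)$ is assumed measurable. In the trivial case $\tau=0$ the interval $[l_0(x),u_0(x)]$ is the whole real line. *)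

theory Defs
  imports "HOL-Probability.Probability"
begin

definition iid_vars :: "'w measure \<Rightarrow> 'b measure \<Rightarrow> ('i \<Rightarrow> 'w \<Rightarrow> 'b) \<Rightarrow> 'i set \<Rightarrow> bool" where
  "iid_vars M S Z I \<longleftrightarrow> prob_space.indep_vars M (\<lambda>_. S) Z I \<and>
     (\<forall>i\<in>I. \<forall>j\<in>I. distr M S (Z i) = distr M S (Z j))"

text \<open>A (sub)sample with index set I is an extensional function on I, so that it lives in the
  product space \<^term>\<open>PiM I (\<lambda>_. borel)\<close>; a function of the subsample cannot see the
  observations outside I.\<close>

type_synonym 'd data = "nat \<Rightarrow> (real ^ 'd) \<times> real"

definition subsample ::
  "nat set \<Rightarrow> (nat \<Rightarrow> 'w \<Rightarrow> real ^ 'd::finite) \<Rightarrow> (nat \<Rightarrow> 'w \<Rightarrow> real) \<Rightarrow> 'w \<Rightarrow> 'd data" where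
  "subsample I X Y \<omega> = (\<lambda>i\<in>I. (X i \<omega>, Y i \<omega>))"

type_synonym 'd net = "real ^ 'd \<Rightarrow> real \<times> real \<times> real"

definition net_l :: "('d::finite) net \<Rightarrow> real ^ 'd \<Rightarrow> real" where
  "net_l N x = fst (N x)"

definition net_m :: "('d::finite) net \<Rightarrow> real ^ 'd \<Rightarrow> real" where
  "net_m N x = fst (snd (N x))"

definition net_u :: "('d::finite) net \<Rightarrow> real ^ 'd \<Rightarrow> real" where
  "net_u N x = snd (snd (N x))"

definition networks :: "('d::finite) net set" where
  "networks = {N. \<forall>x. net_l N x \<le> net_m N x \<and> net_m N x \<le> net_u N x}"

definition pinball :: "real \<Rightarrow> real \<Rightarrow> real" where
  "pinball t v = (t - of_bool (v \<le> 0)) * v"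

definition level_loss :: "real \<Rightarrow> real \<times> real \<times> real \<Rightarrow> real \<Rightarrow> real" where
  "level_loss t p y = (case p of (l, m, u) \<Rightarrow>
     pinball (t / 2) (y - l) + pinball (1 / 2) (y - m) + pinball (1 - t / 2) (y - u))"

text \<open>For an empty index set the risk is the constant 0, so every network minimizes it.\<close>

definition emp_risk :: "nat set \<Rightarrow> ('d::finite) data \<Rightarrow> real \<Rightarrow> 'd net \<Rightarrow> real" where
  "emp_risk I D t N = 1 / real (card I) * (\<Sum>i\<in>I. level_loss t (N (fst (D i))) (snd (D i)))"

definition emp_coverage :: "('d::finite) net \<Rightarrow> nat set \<Rightarrow> 'd data \<Rightarrow> real" where
  "emp_coverage N I D = 1 / real (card I) *
     (\<Sum>i\<in>I. indicator {net_l N (fst (D i)) .. net_u N (fst (D i))} (snd (D i)))"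

definition tau_hat ::
  "nat \<Rightarrow> (nat \<Rightarrow> real) \<Rightarrow> (real \<Rightarrow> ('d::finite) net) \<Rightarrow> nat set \<Rightarrow> 'd data \<Rightarrow> real \<Rightarrow> real" where
  "tau_hat K \<tau> N I D a =
     (if \<exists>i\<in>{1..K}. emp_coverage (N (\<tau> i)) I D \<ge> 1 - a
      then \<tau> (LEAST i. i \<in> {1..K} \<and> emp_coverage (N (\<tau> i)) I D \<ge> 1 - a)
      else 0)"

text \<open>Level 0 gives infinite end points, whatever the value of \<^term>\<open>N 0\<close>.\<close>

definition lower_end :: "(real \<Rightarrow> ('d::finite) net) \<Rightarrow> real \<Rightarrow> real ^ 'd \<Rightarrow> ereal" where
  "lower_end N t x = (if t = 0 then - \<infinity> else ereal (net_l (N t) x))"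

definition upper_end :: "(real \<Rightarrow> ('d::finite) net) \<Rightarrow> real \<Rightarrow> real ^ 'd \<Rightarrow> ereal" where
  "upper_end N t x = (if t = 0 then \<infinity> else ereal (net_u (N t) x))"

definition pred_interval :: "(real \<Rightarrow> ('d::finite) net) \<Rightarrow> real \<Rightarrow> real ^ 'd \<Rightarrow> real set" where
  "pred_interval N t x = {y. lower_end N t x \<le> ereal y \<and> ereal y \<le> upper_end N t x}"

end

theory Submission
  imports Defs "HOL-Probability.Hoeffding"
begin

text \<open>Freeze the training sample, so that the K candidate bands become fixed sets. By Hoeffding's
  inequality and a union bound, the calibration sample accepts some band of true coverage below
  \<open>1 - \<alpha> + \<epsilon>/2\<close> with probability at most \<open>\<delta> = K exp(-n\<^sub>2 \<epsilon>\<^sup>2/2)\<close>. Otherwise the selected band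
  covers an independent new observation with probability at least \<open>1 - \<alpha> + \<epsilon>/2\<close>, so the overall
  coverage is at least \<open>(1 - \<alpha> + \<epsilon>/2)(1 - \<delta>)\<close>, and the bound on \<open>n\<^sub>2\<close> makes this at least
  \<open>1 - \<alpha>\<close>. The estimate is uniform in the frozen training sample, so it integrates.\<close>

section \<open>Empirical frequencies and the selection of the first accepted set\<close>

definition frequency :: "'i set \<Rightarrow> 'b set \<Rightarrow> ('i \<Rightarrow> 'b) \<Rightarrow> real" where
  "frequency I A D = 1 / real (card I) * (\<Sum>i\<in>I. indicator A (D i))"

text \<open>If no set reaches the frequency q, the condition is vacuous: this is the case of level 0,
  where the interval is the whole line.\<close>

definition first_covers ::
  "nat \<Rightarrow> (nat \<Rightarrow> 'b set) \<Rightarrow> real \<Rightarrow> 'i set \<Rightarrow> ('i \<Rightarrow> 'b) \<Rightarrow> 'b \<Rightarrow> bool" where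
  "first_covers K A q I D z \<longleftrightarrow>
     (\<forall>k\<in>{1..K}. q \<le> frequency I (A k) D \<and> (\<forall>j\<in>{1..<k}. frequency I (A j) D < q) \<longrightarrow> z \<in> A k)"

lemma measurable_frequency [measurable (raw)]:
  assumes "finite I" and "\<And>i. i \<in> I \<Longrightarrow> Measurable.pred M (\<lambda>\<omega>. D \<omega> i \<in> A \<omega>)"
  shows "(\<lambda>\<omega>. frequency I (A \<omega>) (D \<omega>)) \<in> borel_measurable M"
proof -
  have "(\<lambda>\<omega>. 1 / real (card I) * (\<Sum>i\<in>I. of_bool (D \<omega> i \<in> A \<omega>) :: real)) \<in> borel_measurable M"
    using assms by measurable
  then show ?thesis
    by (simp add: frequency_def indicator_def of_bool_def)
qed

text \<open>The sets vary with the outcome because the fitted bands depend on the training sample,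
  so measurability is asked of the membership events. What remains is a finite combination of
  comparisons of frequencies with \<open>q\<close>.\<close>

lemma pred_first_covers:
  assumes "finite I"
    and "\<And>i k. i \<in> I \<Longrightarrow> k \<in> {1..K} \<Longrightarrow> Measurable.pred M (\<lambda>\<omega>. D \<omega> i \<in> A \<omega> k)"
    and "\<And>k. k \<in> {1..K} \<Longrightarrow> Measurable.pred M (\<lambda>\<omega>. z \<omega> \<in> A \<omega> k)"
  shows "Measurable.pred M (\<lambda>\<omega>. first_covers K (A \<omega>) q I (D \<omega>) (z \<omega>))"
proof -
  have [measurable]: "(\<lambda>\<omega>. frequency I (A \<omega> k) (D \<omega>)) \<in> borel_measurable M" if "k \<in> {1..K}" for k
    using assms that by (intro measurable_frequency) auto
  have [measurable]: "Measurable.pred M (\<lambda>\<omega>. z \<omega> \<in> A \<omega> k)" if "k \<in> {1..K}" for k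
    using assms(3) that .
  have "Measurable.pred M (\<lambda>\<omega>. q \<le> frequency I (A \<omega> k) (D \<omega>) \<and>
      (\<forall>j\<in>{1..<k}. frequency I (A \<omega> j) (D \<omega>) < q) \<longrightarrow> z \<omega> \<in> A \<omega> k)" if k: "k \<in> {1..K}" for k
  proof -
    have [measurable]: "Measurable.pred M (\<lambda>\<omega>. \<forall>j\<in>{1..<k}. frequency I (A \<omega> j) (D \<omega>) < q)"
    proof (intro pred_intros_finite)
      fix j assume "j \<in> {1..<k}"
      then have [measurable]: "j \<in> {1..K}" using k by simp
      show "Measurable.pred M (\<lambda>\<omega>. frequency I (A \<omega> j) (D \<omega>) < q)" by measurable
    qed simp
    show ?thesis
      using k by measurable
  qed
  then show ?thesis
    unfolding first_covers_def by (intro pred_intros_finite) auto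
qed

section \<open>Integration over an independent variable, and concentration\<close>

text \<open>By independence the joint law is a product, so the probability of \<open>E\<close> is
  the integral of its section probabilities; these are at least \<open>c\<close> on \<open>G\<close>
  and at least 0 elsewhere. Below, \<open>G\<close> is first a set of good calibration samples, then
  the whole space of training samples.\<close>

lemma (in prob_space) indep_var_prob_ge:
  assumes UV: "indep_var S U T V" and E: "E \<in> sets (S \<Otimes>\<^sub>M T)" and G: "G \<in> sets S"
    and c: "\<And>u. u \<in> G \<Longrightarrow> c \<le> prob {\<omega> \<in> space M. (u, V \<omega>) \<in> E}"
  shows "c * prob {\<omega> \<in> space M. U \<omega> \<in> G} \<le> prob {\<omega> \<in> space M. (U \<omega>, V \<omega>) \<in> E}"
proof -
  have [measurable]: "U \<in> measurable M S" "V \<in> measurable M T"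
    and eq: "distr M S U \<Otimes>\<^sub>M distr M T V = distr M (S \<Otimes>\<^sub>M T) (\<lambda>x. (U x, V x))"
    using UV by (auto simp: indep_var_distribution_eq)
  interpret V: prob_space "distr M T V" by (rule prob_space_distr) simp
  have sect: "emeasure (distr M T V) (Pair u -` E) = prob {\<omega> \<in> space M. (u, V \<omega>) \<in> E}" for u
  proof -
    have "emeasure (distr M T V) (Pair u -` E) = emeasure M (V -` (Pair u -` E) \<inter> space M)"
      using E by (intro emeasure_distr) (auto intro: sets_Pair1)
    also have "V -` (Pair u -` E) \<inter> space M = {\<omega> \<in> space M. (u, V \<omega>) \<in> E}" by auto
    finally show ?thesis by (simp add: emeasure_eq_measure)
  qed
  \<comment> \<open>\<open>ennreal\<close> sends a negative \<open>c\<close> to 0 and the chain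
    still holds; such a \<open>c\<close> can occur below, when the bound on the failure probability
    exceeds 1.\<close>
  have "ennreal (c * prob {\<omega> \<in> space M. U \<omega> \<in> G}) = ennreal c * emeasure (distr M S U) G"
    using G by (simp add: emeasure_distr ennreal_mult'' emeasure_eq_measure vimage_def Int_def conj_commute)
  also have "\<dots> = (\<integral>\<^sup>+u. ennreal c * indicator G u \<partial>distr M S U)"
    using G by (simp add: nn_integral_cmult_indicator)
  also have "\<dots> \<le> (\<integral>\<^sup>+u. emeasure (distr M T V) (Pair u -` E) \<partial>distr M S U)"
    using c by (intro nn_integral_mono) (auto simp: sect indicator_def intro: ennreal_leI)
  also have "\<dots> = emeasure (distr M S U \<Otimes>\<^sub>M distr M T V) E"
    using E by (intro V.emeasure_pair_measure_alt[symmetric]) simp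
  also have "\<dots> = prob {\<omega> \<in> space M. (U \<omega>, V \<omega>) \<in> E}"
    using E by (simp add: eq emeasure_distr emeasure_eq_measure vimage_def Int_def conj_commute)
  finally show ?thesis by simp
qed

text \<open>Hoeffding's inequality for the indicators of \<open>A\<close>, which take values in an
  interval of length 1 and whose mean is the probability that \<open>W\<close> lies in
  \<open>A\<close>. It bounds the chance of accepting a set whose true probability falls short of
  \<open>q\<close> by at least \<open>t\<close>.\<close>

lemma (in prob_space) frequency_ge_prob_le:
  assumes fin: "finite I" "I \<noteq> {}" and ind: "indep_vars (\<lambda>_. S) Z I"
    and W: "W \<in> measurable M S" and same: "\<And>i. i \<in> I \<Longrightarrow> distr M S (Z i) = distr M S W"
    and A [measurable]: "Measurable.pred S (\<lambda>z. z \<in> A)" and t: "0 \<le> t"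
    and p: "prob {\<omega> \<in> space M. W \<omega> \<in> A} + t \<le> q"
  shows "prob {\<omega> \<in> space M. q \<le> frequency I A (\<lambda>i\<in>I. Z i \<omega>)} \<le> exp (-2 * real (card I) * t\<^sup>2)"
proof -
  note W [measurable]
  have rv: "Z i \<in> measurable M S" if "i \<in> I" for i
    using ind that by (auto simp: indep_vars_def)
  have ind_A [measurable]: "(indicator A :: _ \<Rightarrow> real) \<in> borel_measurable S"
    using A by (simp add: pred_def borel_measurable_indicator_iff Int_def conj_commute)
  interpret H: Hoeffding_ineq_iid M I "\<lambda>i \<omega>. indicator A (Z i \<omega>)"
      "\<lambda>\<omega>. indicator A (W \<omega>)" 0 1 "expectation (\<lambda>\<omega>. indicator A (W \<omega>))"
  proof unfold_locales
    show "indep_vars (\<lambda>_. borel) (\<lambda>i \<omega>. indicator A (Z i \<omega>) :: real) I"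
      by (intro indep_vars_compose2[OF ind]) simp
    show "distr M borel (\<lambda>\<omega>. indicator A (Z i \<omega>) :: real) = distr M borel (\<lambda>\<omega>. indicator A (W \<omega>))"
      if "i \<in> I" for i
    proof -
      have "distr (distr M S (Z i)) borel (indicator A :: _ \<Rightarrow> real) = distr (distr M S W) borel (indicator A)"
        using same[OF that] by simp
      then show ?thesis
        using rv[OF that] by (simp add: distr_distr comp_def)
    qed
  qed (auto simp: fin indicator_def)
  have e: "expectation (\<lambda>\<omega>. indicator A (W \<omega>)) = prob {\<omega> \<in> space M. W \<omega> \<in> A}"
  proof -
    have "expectation (\<lambda>\<omega>. indicator A (W \<omega>)) =
        expectation (indicator {\<omega> \<in> space M. W \<omega> \<in> A} :: _ \<Rightarrow> real)"
      by (intro Bochner_Integration.integral_cong) (auto simp: indicator_def)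
    then show ?thesis by simp
  qed
  have mean: "(\<lambda>\<omega>. frequency I A (\<lambda>i\<in>I. Z i \<omega>)) = (\<lambda>\<omega>. (\<Sum>i\<in>I. indicator A (Z i \<omega>)) / real (card I))"
    by (simp add: frequency_def)
  have [measurable]: "(\<lambda>\<omega>. (\<Sum>i\<in>I. indicator A (Z i \<omega>)) / real (card I) :: real) \<in> borel_measurable M"
    by (intro borel_measurable_divide borel_measurable_sum measurable_compose[OF rv ind_A]) auto
  have "prob {\<omega> \<in> space M. q \<le> frequency I A (\<lambda>i\<in>I. Z i \<omega>)} \<le> prob {\<omega> \<in> space M.
      prob {\<omega> \<in> space M. W \<omega> \<in> A} + t \<le> (\<Sum>i\<in>I. indicator A (Z i \<omega>)) / real (card I)}"
    unfolding fun_cong[OF mean] using p by (intro finite_measure_mono) auto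
  also have "\<dots> \<le> exp (-2 * real (card I) * t\<^sup>2)"
    using H.Hoeffding_ineq_ge'[OF t _ fin(2)] by (simp add: e)
  finally show ?thesis .
qed

section \<open>Coverage for fixed sets and for fitted sets\<close>

text \<open>Outside an event bounded by \<open>K\<close> Hoeffding terms, the calibration sample
  rejects every set of probability below \<open>q - t\<close>. The set selected is then a good one,
  and the new observation is independent of the selection, which gives the product of the two
  factors.\<close>

lemma (in prob_space) split_coverage:
  fixes Z :: "'i \<Rightarrow> 'a \<Rightarrow> 'b"
  assumes fin: "finite I" "I \<noteq> {}" and j: "j \<notin> I"
    and ind: "indep_vars (\<lambda>_. S) Z (insert j I)"
    and same: "\<And>i. i \<in> I \<Longrightarrow> distr M S (Z i) = distr M S (Z j)"
    and A: "\<And>k. k \<in> {1..K} \<Longrightarrow> Measurable.pred S (\<lambda>z. z \<in> A k)"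
    and t: "0 \<le> t" "t \<le> q" "q - t \<le> 1"
  shows "(q - t) * (1 - real K * exp (-2 * real (card I) * t\<^sup>2)) \<le>
    prob {\<omega> \<in> space M. first_covers K A q I (\<lambda>i\<in>I. Z i \<omega>) (Z j \<omega>)}"
proof -
  define D where "D \<omega> = (\<lambda>i\<in>I. Z i \<omega>)" for \<omega>
  text \<open>Independence of a pair is stated for variables of equal type, hence the singleton product.\<close>
  define V where "V \<omega> = (\<lambda>i\<in>{j}. Z i \<omega>)" for \<omega>
  define p where "p k = prob {\<omega> \<in> space M. Z j \<omega> \<in> A k}" for k
  define B where "B k = {\<omega> \<in> space M. q \<le> frequency I (A k) (D \<omega>)}" for k
  \<comment> \<open>\<open>Ks\<close> marks the sets that cover too rarely, and \<open>G\<close> the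
    calibration samples that accept none of them.\<close>
  define Ks where "Ks = {k \<in> {1..K}. p k < q - t}"
  define G where "G = {D \<in> space (PiM I (\<lambda>_. S)). \<forall>k\<in>Ks. frequency I (A k) D < q}"
  define E where "E = {x \<in> space (PiM I (\<lambda>_. S) \<Otimes>\<^sub>M PiM {j} (\<lambda>_. S)). first_covers K A q I (fst x) (snd x j)}"
  have rv: "Z i \<in> measurable M S" if "i \<in> insert j I" for i
    using ind that by (auto simp: indep_vars_def)
  have D [measurable]: "D \<in> measurable M (PiM I (\<lambda>_. S))"
    unfolding D_def using rv by (intro measurable_restrict) auto
  have freq [measurable]: "frequency I (A k) \<in> borel_measurable (PiM I (\<lambda>_. S))" if "k \<in> {1..K}" for k
  proof (intro measurable_frequency fin)
    fix i assume [measurable]: "i \<in> I"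
    have [measurable]: "Measurable.pred S (\<lambda>z. z \<in> A k)" using A that .
    show "Measurable.pred (PiM I (\<lambda>_. S)) (\<lambda>D. D i \<in> A k)" by measurable
  qed
  have "finite Ks" by (simp add: Ks_def)
  then have G: "G \<in> sets (PiM I (\<lambda>_. S))"
    unfolding G_def using freq by (intro sets.sets_Collect_finite_All) (auto simp: Ks_def)
  have E: "E \<in> sets (PiM I (\<lambda>_. S) \<Otimes>\<^sub>M PiM {j} (\<lambda>_. S))"
  proof -
    have "Measurable.pred (PiM I (\<lambda>_. S) \<Otimes>\<^sub>M PiM {j} (\<lambda>_. S)) (\<lambda>x. first_covers K A q I (fst x) (snd x j))"
    proof (intro pred_first_covers fin)
      fix i k assume [measurable]: "i \<in> I" and k: "k \<in> {1..K}"
      have [measurable]: "Measurable.pred S (\<lambda>z. z \<in> A k)" using A k .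
      show "Measurable.pred (PiM I (\<lambda>_. S) \<Otimes>\<^sub>M PiM {j} (\<lambda>_. S)) (\<lambda>x. fst x i \<in> A k)" by measurable
    next
      fix k assume k: "k \<in> {1..K}"
      have [measurable]: "Measurable.pred S (\<lambda>z. z \<in> A k)" using A k .
      show "Measurable.pred (PiM I (\<lambda>_. S) \<Otimes>\<^sub>M PiM {j} (\<lambda>_. S)) (\<lambda>x. snd x j \<in> A k)" by measurable
    qed
    then show ?thesis by (simp add: E_def pred_def)
  qed
  have indD: "indep_var (PiM I (\<lambda>_. S)) D (PiM {j} (\<lambda>_. S)) V"
    unfolding D_def[abs_def] V_def[abs_def] using j by (intro indep_var_restrict[OF ind]) auto
  have V [measurable]: "V \<in> measurable M (PiM {j} (\<lambda>_. S))"
    using indD by (auto simp: indep_var_distribution_eq)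
  have Vj: "V \<omega> j = Z j \<omega>" for \<omega>
    by (simp add: V_def)
  \<comment> \<open>Union bound: the sample leaves \<open>G\<close> exactly when some index in
    \<open>Ks\<close> is accepted.\<close>
  have "1 - prob {\<omega> \<in> space M. D \<omega> \<in> G} = prob (space M - {\<omega> \<in> space M. D \<omega> \<in> G})"
    using G by (intro prob_compl[symmetric]) simp
  also have "space M - {\<omega> \<in> space M. D \<omega> \<in> G} = (\<Union>k\<in>Ks. B k)"
    using measurable_space[OF D] by (auto simp: G_def B_def not_less)
  also have "prob \<dots> \<le> (\<Sum>k\<in>Ks. prob (B k))"
    using freq \<open>finite Ks\<close> by (intro finite_measure_subadditive_finite) (auto simp: B_def Ks_def)
  also have "\<dots> \<le> (\<Sum>k\<in>Ks. exp (-2 * real (card I) * t\<^sup>2))"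
  proof (intro sum_mono)
    fix k assume k: "k \<in> Ks"
    then have "p k + t \<le> q" by (simp add: Ks_def)
    \<comment> \<open>The new observation \<open>Z j\<close> serves as the variable \<open>W\<close>
      that represents the common law.\<close>
    with k show "prob (B k) \<le> exp (-2 * real (card I) * t\<^sup>2)"
      unfolding B_def D_def p_def using fin ind same rv A t
      by (intro frequency_ge_prob_le[where W = "Z j" and S = S])
         (auto intro: indep_vars_subset simp: Ks_def)
  qed
  also have "\<dots> \<le> real K * exp (-2 * real (card I) * t\<^sup>2)"
  proof -
    have "card Ks \<le> card {1..K}" by (intro card_mono) (auto simp: Ks_def)
    then show ?thesis by simp
  qed
  finally have "(q - t) * (1 - real K * exp (-2 * real (card I) * t\<^sup>2)) \<le>
      (q - t) * prob {\<omega> \<in> space M. D \<omega> \<in> G}"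
    using t by (intro mult_left_mono) auto
  also have "\<dots> \<le> prob {\<omega> \<in> space M. (D \<omega>, V \<omega>) \<in> E}"
  proof (rule indep_var_prob_ge[OF indD E G])
    fix d assume d: "d \<in> G"
    have sp: "(d, V \<omega>) \<in> space (PiM I (\<lambda>_. S) \<Otimes>\<^sub>M PiM {j} (\<lambda>_. S))" if "\<omega> \<in> space M" for \<omega>
      using d measurable_space[OF V that] by (auto simp: G_def space_pair_measure)
    show "q - t \<le> prob {\<omega> \<in> space M. (d, V \<omega>) \<in> E}"
    proof (cases "\<exists>k\<in>{1..K}. q \<le> frequency I (A k) d \<and> (\<forall>j\<in>{1..<k}. frequency I (A j) d < q)")
      case True
      then obtain k where k: "k \<in> {1..K}" "q \<le> frequency I (A k) d"
        "\<And>j. j \<in> {1..<k} \<Longrightarrow> frequency I (A j) d < q" by blast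
      \<comment> \<open>Of two distinct first accepted indices, the smaller is accepted before the
        larger, a contradiction. So \<open>first_covers\<close> reduces to membership in the single
        set \<open>A k\<close>.\<close>
      have uniq: "k' = k" if "k' \<in> {1..K}" "q \<le> frequency I (A k') d"
        "\<forall>j\<in>{1..<k'}. frequency I (A j) d < q" for k'
      proof (rule ccontr)
        assume "k' \<noteq> k"
        then have "k \<in> {1..<k'} \<or> k' \<in> {1..<k}" using k(1) that(1) by auto
        then show False using k that by fastforce
      qed
      have "first_covers K A q I d z \<longleftrightarrow> z \<in> A k" for z
        unfolding first_covers_def using k uniq by blast
      then have "{\<omega> \<in> space M. (d, V \<omega>) \<in> E} = {\<omega> \<in> space M. Z j \<omega> \<in> A k}"
        using sp by (auto simp: E_def Vj)
      \<comment> \<open>Since \<open>d\<close> lies in \<open>G\<close> and accepts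
        \<open>k\<close>, the index \<open>k\<close> is not in \<open>Ks\<close>.\<close>
      moreover have "q - t \<le> p k"
        using d k by (force simp: G_def Ks_def not_less)
      ultimately show ?thesis by (simp add: p_def)
    next
      \<comment> \<open>Nothing is selected, so coverage is certain and \<open>q - t \<le> 1\<close>
        suffices.\<close>
      case False
      then have "{\<omega> \<in> space M. (d, V \<omega>) \<in> E} = space M"
        using sp by (auto simp: E_def first_covers_def)
      then show ?thesis using t by (simp add: prob_space)
    qed
  qed
  also have "{\<omega> \<in> space M. (D \<omega>, V \<omega>) \<in> E} = {\<omega> \<in> space M. first_covers K A q I (D \<omega>) (Z j \<omega>)}"
    using measurable_space[OF D] measurable_space[OF V] by (auto simp: E_def space_pair_measure Vj)
  finally show ?thesis by (simp add: D_def)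
qed

text \<open>Once the training sample on \<open>J\<close> is fixed, the sets are fixed and
  \<open>split_coverage\<close> applies. Its bound does not depend on the training sample, so
  integration preserves it. Joint measurability of the sets supplies both the event and its
  sections.\<close>

lemma (in prob_space) fitted_split_coverage:
  fixes Z :: "'i \<Rightarrow> 'a \<Rightarrow> 'b" and A :: "('i \<Rightarrow> 'b) \<Rightarrow> nat \<Rightarrow> 'b set"
  assumes fin: "finite I" "I \<noteq> {}" and j: "j \<notin> I" "j \<notin> J" "I \<inter> J = {}"
    and ind: "indep_vars (\<lambda>_. S) Z (insert j (I \<union> J))"
    and same: "\<And>i. i \<in> I \<Longrightarrow> distr M S (Z i) = distr M S (Z j)"
    and A: "\<And>k. k \<in> {1..K} \<Longrightarrow>
      Measurable.pred (PiM J (\<lambda>_. S) \<Otimes>\<^sub>M S) (\<lambda>x. snd x \<in> A (fst x) k)"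
    and t: "0 \<le> t" "t \<le> q" "q - t \<le> 1"
  shows "(q - t) * (1 - real K * exp (-2 * real (card I) * t\<^sup>2)) \<le>
    prob {\<omega> \<in> space M. first_covers K (A (\<lambda>i\<in>J. Z i \<omega>)) q I (\<lambda>i\<in>I. Z i \<omega>) (Z j \<omega>)}"
proof -
  define T where "T = PiM J (\<lambda>_. S)"
  define R where "R = PiM (insert j I) (\<lambda>_. S)"
  define U where "U \<omega> = (\<lambda>i\<in>J. Z i \<omega>)" for \<omega>
  \<comment> \<open>Calibration sample and new observation form one block, independent of the
    training block \<open>U\<close>.\<close>
  define V where "V \<omega> = (\<lambda>i\<in>insert j I. Z i \<omega>)" for \<omega>
  define E where "E = {x \<in> space (T \<Otimes>\<^sub>M R).
    first_covers K (A (fst x)) q I (restrict (snd x) I) (snd x j)}"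
  have A' [measurable]: "Measurable.pred (T \<Otimes>\<^sub>M S) (\<lambda>x. snd x \<in> A (fst x) k)"
    if "k \<in> {1..K}" for k
    using A[OF that] by (simp add: T_def)
  have E: "E \<in> sets (T \<Otimes>\<^sub>M R)"
  proof -
    have comp: "Measurable.pred (T \<Otimes>\<^sub>M R) (\<lambda>x. snd x i \<in> A (fst x) k)"
      if [measurable]: "i \<in> insert j I" and "k \<in> {1..K}" for i k
    proof -
      have "(\<lambda>x. (fst x, snd x i)) \<in> measurable (T \<Otimes>\<^sub>M R) (T \<Otimes>\<^sub>M S)"
        unfolding R_def by measurable
      from measurable_compose[OF this A'[OF that(2)]] show ?thesis by simp
    qed
    have "Measurable.pred (T \<Otimes>\<^sub>M R)
        (\<lambda>x. first_covers K (A (fst x)) q I (restrict (snd x) I) (snd x j))"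
      using comp by (intro pred_first_covers fin) auto
    then show ?thesis by (simp add: E_def pred_def)
  qed
  have UV: "indep_var T U R V"
    unfolding T_def R_def U_def[abs_def] V_def[abs_def]
    using j by (intro indep_var_restrict[OF ind]) auto
  then have [measurable]: "U \<in> measurable M T" and V [measurable]: "V \<in> measurable M R"
    by (auto simp: indep_var_distribution_eq)
  have restr: "restrict (V \<omega>) I = (\<lambda>i\<in>I. Z i \<omega>)" "V \<omega> j = Z j \<omega>" for \<omega>
    by (auto simp: V_def)
  \<comment> \<open>The section bound holds for every training sample, so \<open>G\<close> is all of
    \<open>space T\<close>, an event of probability 1.\<close>
  have "(q - t) * (1 - real K * exp (-2 * real (card I) * t\<^sup>2)) * prob {\<omega> \<in> space M. U \<omega> \<in> space T}
      \<le> prob {\<omega> \<in> space M. (U \<omega>, V \<omega>) \<in> E}"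
  proof (rule indep_var_prob_ge[OF UV E sets.top])
    fix u assume u: "u \<in> space T"
    have "Measurable.pred S (\<lambda>z. z \<in> A u k)" if "k \<in> {1..K}" for k
      using measurable_compose[OF measurable_Pair1'[OF u] A'[OF that]] by simp
    then have "(q - t) * (1 - real K * exp (-2 * real (card I) * t\<^sup>2)) \<le>
        prob {\<omega> \<in> space M. first_covers K (A u) q I (\<lambda>i\<in>I. Z i \<omega>) (Z j \<omega>)}"
      using indep_vars_subset[OF ind, of "insert j I"]
      by (intro split_coverage fin j(1) t) (auto simp: same)
    also have "{\<omega> \<in> space M. first_covers K (A u) q I (\<lambda>i\<in>I. Z i \<omega>) (Z j \<omega>)} =
        {\<omega> \<in> space M. (u, V \<omega>) \<in> E}"
      using u measurable_space[OF V] by (auto simp: E_def space_pair_measure restr)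
    finally show "(q - t) * (1 - real K * exp (-2 * real (card I) * t\<^sup>2)) \<le>
        prob {\<omega> \<in> space M. (u, V \<omega>) \<in> E}" .
  qed
  also have "{\<omega> \<in> space M. U \<omega> \<in> space T} = space M"
    using measurable_space[of U M T] by auto
  also have "{\<omega> \<in> space M. (U \<omega>, V \<omega>) \<in> E} =
      {\<omega> \<in> space M. first_covers K (A (U \<omega>)) q I (\<lambda>i\<in>I. Z i \<omega>) (Z j \<omega>)}"
    using measurable_space[of U M T] measurable_space[OF V]
    by (auto simp: E_def space_pair_measure restr)
  finally show ?thesis by (simp add: prob_space U_def)
qed

section \<open>From network bands to sets of observations\<close>

text \<open>Despite the name, this is the closed region between the outer two outputs of the
  network, not a function graph.\<close>

definition net_graph :: "('d::finite) net \<Rightarrow> ((real ^ 'd) \<times> real) set" where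
  "net_graph N = {z. net_l N (fst z) \<le> snd z \<and> snd z \<le> net_u N (fst z)}"

lemma emp_coverage_eq_frequency: "emp_coverage N I D = frequency I (net_graph N) D"
  by (auto simp: emp_coverage_def frequency_def net_graph_def indicator_def intro!: sum.cong)

text \<open>The least accepted index is the only one that meets the premise in
  \<open>first_covers\<close>. Nonzero levels keep a selected level apart from the default 0, whose
  end points are infinite.\<close>

lemma pred_interval_tau_hat_iff:
  fixes N :: "real \<Rightarrow> ('d::finite) net"
  assumes pos: "\<And>i. i \<in> {1..K} \<Longrightarrow> \<tau> i \<noteq> 0"
  shows "y \<in> pred_interval N (tau_hat K \<tau> N I D a) x \<longleftrightarrow>
    first_covers K (\<lambda>k. net_graph (N (\<tau> k))) (1 - a) I D (x, y)"
proof (cases "\<exists>i\<in>{1..K}. 1 - a \<le> emp_coverage (N (\<tau> i)) I D")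
  case True
  define k where "k = (LEAST i. i \<in> {1..K} \<and> 1 - a \<le> emp_coverage (N (\<tau> i)) I D)"
  have k: "k \<in> {1..K}" "1 - a \<le> emp_coverage (N (\<tau> k)) I D"
    using LeastI_ex[of "\<lambda>i. i \<in> {1..K} \<and> 1 - a \<le> emp_coverage (N (\<tau> i)) I D"] True
    unfolding k_def by blast+
  have less: "emp_coverage (N (\<tau> i)) I D < 1 - a" if "i \<in> {1..<k}" for i
    using not_less_Least[of i "\<lambda>i. i \<in> {1..K} \<and> 1 - a \<le> emp_coverage (N (\<tau> i)) I D"] that k
    unfolding k_def[symmetric] by (auto simp: not_le)
  have "i = k" if "i \<in> {1..K}" "1 - a \<le> emp_coverage (N (\<tau> i)) I D"
    "\<forall>j\<in>{1..<i}. emp_coverage (N (\<tau> j)) I D < 1 - a" for i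
  proof (rule ccontr)
    assume "i \<noteq> k"
    then have "k \<in> {1..<i} \<or> i \<in> {1..<k}" using k(1) that(1) by auto
    then show False using k less that by fastforce
  qed
  then have "first_covers K (\<lambda>k. net_graph (N (\<tau> k))) (1 - a) I D (x, y) \<longleftrightarrow>
      (x, y) \<in> net_graph (N (\<tau> k))"
    unfolding first_covers_def emp_coverage_eq_frequency[symmetric] using k less by blast
  moreover have "tau_hat K \<tau> N I D a = \<tau> k"
    using True by (simp add: tau_hat_def k_def)
  ultimately show ?thesis
    using pos[OF k(1)] by (simp add: pred_interval_def lower_end_def upper_end_def net_graph_def)
next
  \<comment> \<open>Both sides are true: the level is 0, with the whole line as interval, and
    \<open>first_covers\<close> is vacuous.\<close>
  case False
  then show ?thesis
    by (auto simp: tau_hat_def pred_interval_def lower_end_def upper_end_def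
        first_covers_def emp_coverage_eq_frequency)
qed

section \<open>Coverage under the stated calibration size\<close>

theorem corollary1:
  fixes M :: "'w measure"
    and n K :: nat
    and \<alpha> \<epsilon> :: real
    and X :: "nat \<Rightarrow> 'w \<Rightarrow> real ^ 'd::finite"
    and Y :: "nat \<Rightarrow> 'w \<Rightarrow> real"
    and Xnew :: "'w \<Rightarrow> real ^ 'd"
    and Ynew :: "'w \<Rightarrow> real"
    and I1 I2 :: "nat set"
    and \<tau> :: "nat \<Rightarrow> real"
    and arch :: "real \<Rightarrow> 'd data \<Rightarrow> 'd net set"
    and N :: "real \<Rightarrow> 'd data \<Rightarrow> 'd net"
  assumes "prob_space M"
    and "0 < \<alpha>" and "\<alpha> < 1" and "0 < \<epsilon>" and "\<alpha> - \<epsilon> > 0"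
    and iid: "iid_vars M borel
      (\<lambda>i \<omega>. if i = 0 then (Xnew \<omega>, Ynew \<omega>) else (X i \<omega>, Y i \<omega>)) {0..n}"
    and split: "I1 \<union> I2 = {1..n}" "I1 \<inter> I2 = {}" "I2 \<noteq> {}"
    and levels: "K \<ge> 1" "\<forall>i\<in>{1..K}. 0 < \<tau> i \<and> \<tau> i < 1"
      "\<forall>i\<in>{1..K}. \<forall>j\<in>{1..K}. i < j \<longrightarrow> \<tau> j < \<tau> i"
    and arch: "\<forall>i\<in>{1..K}. \<forall>\<omega>\<in>space M. arch (\<tau> i) (subsample I1 X Y \<omega>) \<subseteq> networks"
    and fit: "\<forall>i\<in>{1..K}. \<forall>\<omega>\<in>space M.
      is_arg_min (emp_risk I1 (subsample I1 X Y \<omega>) (\<tau> i))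
        (\<lambda>N'. N' \<in> arch (\<tau> i) (subsample I1 X Y \<omega>)) (N (\<tau> i) (subsample I1 X Y \<omega>))"
    and meas: "\<forall>i\<in>{1..K}. (\<lambda>(D1, x). N (\<tau> i) D1 x)
      \<in> borel_measurable (PiM I1 (\<lambda>_. borel) \<Otimes>\<^sub>M borel)"
    and n2: "real (card I2) \<ge> - 2 * ln (\<epsilon> / (2 * real K * (1 - \<alpha> + \<epsilon> / 2))) / \<epsilon>\<^sup>2"
  shows "measure M {\<omega> \<in> space M.
      Ynew \<omega> \<in> pred_interval (\<lambda>t. N t (subsample I1 X Y \<omega>))
        (tau_hat K \<tau> (\<lambda>t. N t (subsample I1 X Y \<omega>)) I2 (subsample I2 X Y \<omega>) (\<alpha> - \<epsilon>))
        (Xnew \<omega>)} \<ge> 1 - \<alpha>"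
proof -
  interpret prob_space M by (rule assms(1))
  note bounds = assms(2-5)
  \<comment> \<open>Index 0 holds the new observation; it lies outside \<open>I1\<close> and
    \<open>I2\<close>, whose indices start at 1.\<close>
  define Z where "Z i \<omega> = (if i = 0 then (Xnew \<omega>, Ynew \<omega>) else (X i \<omega>, Y i \<omega>))" for i \<omega>
  define A where "A D k = net_graph (N (\<tau> k) D)" for D k
  define q where "q = 1 - (\<alpha> - \<epsilon>)"
  \<comment> \<open>The admissible failure probability:
    \<open>q - \<epsilon> / 2 = 1 - \<alpha> + \<epsilon> / 2\<close>, and a factor
    \<open>1 - \<delta>\<close> lowers this by exactly \<open>\<epsilon> / 2\<close>, to
    \<open>1 - \<alpha>\<close>.\<close>
  define \<delta> where "\<delta> = \<epsilon> / (2 * (1 - \<alpha> + \<epsilon> / 2))"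
  have un: "insert 0 (I2 \<union> I1) = {0..n}"
    using split(1) by auto
  have zero: "0 \<notin> I1" "0 \<notin> I2"
    using split(1) by (auto simp: set_eq_iff)
  have fin: "finite I2"
    using split(1) by (metis finite_Un finite_atLeastAtMost)
  have "iid_vars M borel Z (insert 0 (I2 \<union> I1))"
    using iid unfolding un Z_def[abs_def] .
  then have ind: "indep_vars (\<lambda>_. borel) Z (insert 0 (I2 \<union> I1))"
    and same: "\<And>i. i \<in> I2 \<Longrightarrow> distr M borel (Z i) = distr M borel (Z 0)"
    unfolding iid_vars_def by blast+
  have samp: "subsample I1 X Y \<omega> = (\<lambda>i\<in>I1. Z i \<omega>)" "subsample I2 X Y \<omega> = (\<lambda>i\<in>I2. Z i \<omega>)" for \<omega>
    using zero by (auto simp: subsample_def Z_def)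
  have K: "real K > 0" using levels(1) by simp
  have d: "\<delta> > 0" using bounds by (simp add: \<delta>_def)
  \<comment> \<open>With \<open>t = \<epsilon> / 2\<close> the Hoeffding exponent is
    \<open>- card I2 * \<epsilon>\<^sup>2 / 2\<close>, and the assumption on the calibration size
    says that it is at most \<open>ln (\<delta> / K)\<close>.\<close>
  have "exp (-2 * real (card I2) * (\<epsilon> / 2)\<^sup>2) \<le> exp (ln (\<delta> / real K))"
  proof -
    have "\<epsilon> / (2 * real K * (1 - \<alpha> + \<epsilon> / 2)) = \<delta> / real K"
      by (simp add: \<delta>_def)
    with n2 have "- 2 * ln (\<delta> / real K) / \<epsilon>\<^sup>2 \<le> real (card I2)"
      by simp
    then have "- 2 * ln (\<delta> / real K) \<le> real (card I2) * \<epsilon>\<^sup>2"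
      using \<open>0 < \<epsilon>\<close> by (subst (asm) pos_divide_le_eq) auto
    then show ?thesis by (simp add: power_divide)
  qed
  then have "real K * exp (-2 * real (card I2) * (\<epsilon> / 2)\<^sup>2) \<le> \<delta>"
    using K d by (simp add: field_simps)
  moreover have "q - \<epsilon> / 2 \<ge> 0" using bounds by (simp add: q_def)
  ultimately have "(q - \<epsilon> / 2) * (1 - \<delta>) \<le>
      (q - \<epsilon> / 2) * (1 - real K * exp (-2 * real (card I2) * (\<epsilon> / 2)\<^sup>2))"
    by (intro mult_left_mono) auto
  also have "\<dots> \<le> prob {\<omega> \<in> space M.
      first_covers K (A (\<lambda>i\<in>I1. Z i \<omega>)) q I2 (\<lambda>i\<in>I2. Z i \<omega>) (Z 0 \<omega>)}"
  proof (rule fitted_split_coverage[OF fin split(3) zero(2,1) _ ind same])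
    let ?P = "PiM I1 (\<lambda>_. borel :: ((real ^ 'd) \<times> real) measure) \<Otimes>\<^sub>M
      (borel :: ((real ^ 'd) \<times> real) measure)"
    \<comment> \<open>On a product type \<open>borel\<close> comes from the product topology, so the
      projections are measurable by continuity.\<close>
    have proj: "fst \<in> borel_measurable (borel :: ((real ^ 'd) \<times> real) measure)"
      "snd \<in> borel_measurable (borel :: ((real ^ 'd) \<times> real) measure)"
      "fst \<in> borel_measurable (borel :: (real \<times> real \<times> real) measure)"
      "(\<lambda>p. snd (snd p)) \<in> borel_measurable (borel :: (real \<times> real \<times> real) measure)"
      by (intro borel_measurable_continuous_onI continuous_intros)+
    fix k assume "k \<in> {1..K}"
    then have N: "(\<lambda>(D1, x). N (\<tau> k) D1 x)
        \<in> borel_measurable (PiM I1 (\<lambda>_. borel) \<Otimes>\<^sub>M borel)"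
      using meas by blast
    \<comment> \<open>Forgetting the response carries the measurability of the fit from pairs
      \<open>(D1, x)\<close> over to training sample and full observation.\<close>
    have "(\<lambda>x. (fst x, fst (snd x))) \<in> ?P \<rightarrow>\<^sub>M PiM I1 (\<lambda>_. borel) \<Otimes>\<^sub>M borel"
      by (intro measurable_Pair measurable_fst measurable_compose[OF measurable_snd proj(1)])
    from measurable_compose[OF this N]
    have N': "(\<lambda>x. N (\<tau> k) (fst x) (fst (snd x))) \<in> borel_measurable ?P"
      by simp
    show "Measurable.pred ?P (\<lambda>x. snd x \<in> A (fst x) k)"
      unfolding A_def net_graph_def net_l_def net_u_def mem_Collect_eq
      using measurable_compose[OF N' proj(3)] measurable_compose[OF N' proj(4)]
        measurable_compose[OF measurable_snd proj(2)]
      by (intro pred_intros_logic borel_measurable_le[folded pred_def]) simp_all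
  qed (use bounds split(2) in \<open>auto simp: q_def\<close>)
  also have "{\<omega> \<in> space M.
      first_covers K (A (\<lambda>i\<in>I1. Z i \<omega>)) q I2 (\<lambda>i\<in>I2. Z i \<omega>) (Z 0 \<omega>)} = {\<omega> \<in> space M.
      Ynew \<omega> \<in> pred_interval (\<lambda>t. N t (subsample I1 X Y \<omega>))
        (tau_hat K \<tau> (\<lambda>t. N t (subsample I1 X Y \<omega>)) I2 (subsample I2 X Y \<omega>) (\<alpha> - \<epsilon>))
        (Xnew \<omega>)}"
  proof -
    have iff: "y \<in> pred_interval N' (tau_hat K \<tau> N' I2 D a) x \<longleftrightarrow>
        first_covers K (\<lambda>k. net_graph (N' (\<tau> k))) (1 - a) I2 D (x, y)"
      for y N' D a and x :: "real ^ 'd"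
      using levels(2) by (intro pred_interval_tau_hat_iff) fastforce
    have "Z 0 \<omega> = (Xnew \<omega>, Ynew \<omega>)" for \<omega>
      by (simp add: Z_def)
    then show ?thesis
      by (simp add: iff samp A_def[abs_def] q_def)
  qed
  also have "(q - \<epsilon> / 2) * (1 - \<delta>) = 1 - \<alpha>"
    using bounds by (simp add: q_def \<delta>_def field_simps)
  finally show ?thesis .
qed

end
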